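(* Let $\delta\geq 1$, $k\geq 0$, $h=k+1$, $t\geq 1$, $n\geq 2$ and $m$ be integers with $2m\ge n\delta$, and let $s$ be an integer with $$\frac{n}{t+1}\leq s\leq\frac{n}{t}\qquad\text{and}\qquad 2m=n(\delta+th)-\frac{s\,h\,t(t+1)}{2}.$$ Let $P$ be the sequence consisting of $s$ copies of each of $\delta,\delta+h,\ldots,\delta+(t-1)h$ and $n-ts$ copies of $\delta+th$. Let $b=n-ts$, and suppose that $s\geq\delta+(t-1)h+1$, that $s(\delta+ih)$ is even for $0\leq i<t$, and that either $b=0$ or $b\geq\delta+th+1$ with $b(\delta+th)$ even. Let $G_0$ be the disjoint union of a $(\delta+ih)$-regular circulant graph on $s$ vertices for each $0\leq i<t$ and, if $b>0$, of a $(\delta+th)$-regular circulant graph on $b$ vertices. Then $G_0$ has degree sequence $P$ and $\mathrm{sp}(G_0,k)=s=f_t(n,m,\delta,k)$; and for $\delta\geq 2$ there is also a connected graph with the same degree sequence $P$.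
   Context: Graphs are finite and simple. For a graph $G$ and $B\subseteq V(G)$ the spread is $\mathrm{sp}(B)=\max_{u\in B}\deg_G(u)-\min_{v\in B}\deg_G(v)$, and $\mathrm{sp}(G,k)$ is the largest cardinality of a set $B\subseteq V(G)$ with $\mathrm{sp}(B)\leq k$. Further, $$f_t(n,m,\delta,k)=\frac{2\left(n(\delta+t(k+1))-2m\right)}{(k+1)\,t(t+1)}.$$ The $q$-regular circulant graph on $r$ vertices, for $r\geq q+1$ and $qr$ even, may be taken to be the graph on $\mathbb{Z}/r\mathbb{Z}$ in which $i$ is joined to $i\pm1,\ldots,i\pm\lfloor q/2\rfloor$, and also to $i+r/2$ when $q$ is odd. *)

theory Defs
  imports
    Complex_Main
    "HOL-Library.Multiset"
    "HOL-Number_Theory.Cong"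
    "Graph_Theory.Graph_Theory"
begin

(* Finite simple graphs are the finite, loop-free, symmetric digraphs of the locale pair_graph:
   an edge uv is represented by the two arcs (u, v) and (v, u), so that the degree of a vertex
   is its out-degree. *)
abbreviation deg :: "'a pair_pre_digraph \<Rightarrow> 'a \<Rightarrow> nat" where
  "deg G v \<equiv> out_degree (with_proj G) v"

(* The order in which the degrees are listed is immaterial. *)
definition has_degree_sequence :: "'a pair_pre_digraph \<Rightarrow> nat list \<Rightarrow> bool" where
  "has_degree_sequence G ds \<longleftrightarrow> mset ds = image_mset (deg G) (mset_set (pverts G))"

(* Meaningful for finite nonempty B only; there Max \<ge> Min, so the subtraction does not truncate. *)
definition spread :: "'a pair_pre_digraph \<Rightarrow> 'a set \<Rightarrow> nat" where
  "spread G B = Max (deg G ` B) - Min (deg G ` B)"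

definition max_spread_card :: "'a pair_pre_digraph \<Rightarrow> nat \<Rightarrow> nat" where
  "max_spread_card G k = Max {card B | B. B \<subseteq> pverts G \<and> B \<noteq> {} \<and> spread G B \<le> k}"

definition spread_bound :: "nat \<Rightarrow> nat \<Rightarrow> nat \<Rightarrow> nat \<Rightarrow> nat \<Rightarrow> real" where
  "spread_bound t n m \<delta> k =
     2 * (real n * (real \<delta> + real t * (real k + 1)) - 2 * real m)
       / ((real k + 1) * real t * (real t + 1))"

(* The residues modulo r are represented by 0, ..., r - 1. This is a q-regular simple graph
   whenever r \<ge> q + 1 and q * r is even. *)
definition circulant :: "nat \<Rightarrow> nat \<Rightarrow> nat pair_pre_digraph" where
  "circulant r q =
     \<lparr> pverts = {..<r},
       parcs = {(i, j). i < r \<and> j < r \<and>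
         ((\<exists>d \<in> {1..q div 2}. [j = i + d] (mod r) \<or> [i = j + d] (mod r)) \<or>
          (odd q \<and> [j = i + r div 2] (mod r)))} \<rparr>"

definition disjoint_union :: "'i set \<Rightarrow> ('i \<Rightarrow> 'a pair_pre_digraph) \<Rightarrow> ('i \<times> 'a) pair_pre_digraph" where
  "disjoint_union I H =
     \<lparr> pverts = Sigma I (\<lambda>i. pverts (H i)),
       parcs = {((i, u), (i, v)) | i u v. i \<in> I \<and> (u, v) \<in> parcs (H i)} \<rparr>"

end

theory Submission
  imports Defs
begin

text \<open>Degrees of vertices in different components of the disjoint union differ by at least
  \<open>h = k + 1\<close>, so a set of spread at most \<open>k\<close> lies in one component, and no component has more
  than \<open>s\<close> vertices.

  A circulant graph of degree at least 2 contains the Hamiltonian cycle \<open>0, 1, \<dots>, r - 1\<close>. Deleting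
  the edge \<open>{0, 1}\<close> in every component leaves it connected, and joining the vertex 1 of each
  component to the vertex 0 of the next one, cyclically, restores all degrees and makes the whole
  graph connected.\<close>

section \<open>Degrees and isomorphic copies\<close>

text \<open>An arc is determined by its tail and head, so a degree can be counted through any
  injective parametrisation of the neighbours. Relabelled, circulant and twisted graphs all get
  their degrees this way.\<close>

lemma deg_eq_card_image:
  assumes "inj_on f A" "\<And>w. (v, w) \<in> parcs G \<longleftrightarrow> w \<in> f ` A"
  shows "deg G v = card A"
proof -
  have "out_arcs (with_proj G) v = (\<lambda>x. (v, f x)) ` A"
    using assms(2) by (auto simp: out_arcs_def)
  moreover have "inj_on (\<lambda>x. (v, f x)) A"
    using assms(1) by (auto simp: inj_on_def)
  ultimately show ?thesis
    by (simp add: out_degree_def card_image)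
qed

lemma deg_eq_card: "deg G v = card {w. (v, w) \<in> parcs G}"
  by (rule deg_eq_card_image[where f = id]) auto

text \<open>Heads of arcs are vertices because each reversed arc is again an arc, and then finitely
  many vertices allow only finitely many arcs.\<close>

lemma pair_graphI:
  assumes "finite (pverts G)"
    and "\<And>u v. (u, v) \<in> parcs G \<Longrightarrow> u \<in> pverts G \<and> u \<noteq> v \<and> (v, u) \<in> parcs G"
  shows "pair_graph G"
proof -
  have sub: "parcs G \<subseteq> pverts G \<times> pverts G"
    using assms(2) by auto
  then have "finite (parcs G)"
    using assms(1) by (meson finite_SigmaI finite_subset)
  then show ?thesis
    using assms sub by unfold_locales (auto simp: symmetric_def intro!: symI)
qed

text \<open>Twisted unions have pairs as vertices, while the connected graph is sought on natural
  numbers; an injective relabelling bridges the two types.\<close>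

definition map_graph :: "('a \<Rightarrow> 'b) \<Rightarrow> 'a pair_pre_digraph \<Rightarrow> 'b pair_pre_digraph" where
  "map_graph f G = \<lparr> pverts = f ` pverts G, parcs = map_prod f f ` parcs G \<rparr>"

lemma pverts_map_graph [simp]: "pverts (map_graph f G) = f ` pverts G"
  and parcs_map_graph [simp]: "parcs (map_graph f G) = map_prod f f ` parcs G"
  by (simp_all add: map_graph_def)

lemma pair_graph_map_graph:
  assumes "pair_graph G" "inj f"
  shows "pair_graph (map_graph f G)"
proof -
  interpret pair_graph G by fact
  show ?thesis
  proof (rule pair_graphI)
    fix u v assume "(u, v) \<in> parcs (map_graph f G)"
    then obtain x y where xy: "u = f x" "v = f y" "(x, y) \<in> parcs G"
      by auto
    then have "(y, x) \<in> parcs G" "x \<noteq> y" "x \<in> pverts G"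
      by (auto intro: arcs_symmetric dest: no_loops' in_arcsD1)
    then show "u \<in> pverts (map_graph f G) \<and> u \<noteq> v \<and> (v, u) \<in> parcs (map_graph f G)"
      using xy \<open>inj f\<close> by (force simp: inj_eq)
  qed (simp add: pair_finite_verts)
qed

lemma deg_map_graph:
  assumes "inj f"
  shows "deg (map_graph f G) (f v) = deg G v"
proof -
  have "deg (map_graph f G) (f v) = card {w. (v, w) \<in> parcs G}"
  proof (rule deg_eq_card_image)
    show "inj_on f {w. (v, w) \<in> parcs G}"
      using assms by (rule inj_on_subset) simp
    show "(f v, w) \<in> parcs (map_graph f G) \<longleftrightarrow> w \<in> f ` {w. (v, w) \<in> parcs G}" for w
      using injD[OF assms] by fastforce
  qed
  then show ?thesis
    by (simp only: deg_eq_card)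
qed

lemma has_degree_sequence_map_graph:
  assumes "inj f" "has_degree_sequence G ds"
  shows "has_degree_sequence (map_graph f G) ds"
proof -
  have "mset_set (f ` pverts G) = image_mset f (mset_set (pverts G))"
    using assms(1) by (simp add: image_mset_mset_set inj_on_subset)
  then show ?thesis
    using assms by (simp add: has_degree_sequence_def deg_map_graph image_mset.compositionality comp_def)
qed

text \<open>By symmetry a walk from the root \<open>x\<close> can be reversed, so any two vertices
  are joined through \<open>x\<close>.\<close>

lemma connected_if_reachable_from:
  assumes "pair_graph G" "x \<in> pverts G"
    and reach: "\<And>v. v \<in> pverts G \<Longrightarrow> reachable (with_proj G) x v"
  shows "Digraph_Component.connected (with_proj G)"
proof -
  interpret pair_graph G by fact
  have "reachable (with_proj G) u v" if "u \<in> pverts G" "v \<in> pverts G" for u v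
    using that reach by (meson reachable_trans symmetric_reachable')
  then show ?thesis
    unfolding connected_def using assms(2)
    by (intro strongly_connectedI) (auto intro: reachable_mk_symmetricI)
qed

text \<open>In a symmetric digraph connectedness gives directed walks from a root, and
  \<open>f\<close> carries these over arc by arc.\<close>

lemma connected_map_graph:
  assumes "pair_graph G" "inj f" "Digraph_Component.connected (with_proj G)"
  shows "Digraph_Component.connected (with_proj (map_graph f G))"
proof -
  interpret G: pair_graph G by fact
  interpret H: pair_graph "map_graph f G" by (rule pair_graph_map_graph) fact+
  have sc: "strongly_connected (with_proj G)"
    using assms(3) G.sym_arcs by (intro G.symmetric_connected_imp_strongly_connected)
  then obtain x where x: "x \<in> pverts G"
    by (auto simp: strongly_connected_def)
  have "reachable (with_proj (map_graph f G)) (f x) (f v)" if "reachable (with_proj G) x v" for v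
    using that
  proof (induction rule: G.reachable_induct)
    case base
    then show ?case by auto
  next
    case (step v w)
    from step have "(f v, f w) \<in> parcs (map_graph f G)" by force
    with step.IH show ?case by (rule H.reachable_adj_trans)
  qed
  then show ?thesis
    using sc x by (intro connected_if_reachable_from[of _ "f x"] H.pair_graph) (auto simp: strongly_connected_def)
qed

section \<open>Circulant graphs\<close>

lemma pverts_circulant [simp]: "pverts (circulant r q) = {..<r}"
  by (simp add: circulant_def)

lemma parcs_circulant:
  "(i, j) \<in> parcs (circulant r q) \<longleftrightarrow> i < r \<and> j < r \<and>
     ((\<exists>d \<in> {1..q div 2}. [j = i + d] (mod r) \<or> [i = j + d] (mod r)) \<or>
      (odd q \<and> [j = i + r div 2] (mod r)))"
  by (simp add: circulant_def)

text \<open>On residues a step back by \<open>d\<close> is a step forward by \<open>r - d\<close>.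
  Hence all neighbours of \<open>i\<close> are reached by forward steps from a set that is
  independent of \<open>i\<close> and lies below \<open>r\<close>, which makes them countable
  without repetition.\<close>

lemma parcs_circulant_iff:
  assumes "q < r" "i < r"
  shows "(i, j) \<in> parcs (circulant r q) \<longleftrightarrow>
    j \<in> (\<lambda>d. (i + d) mod r) ` ({1..q div 2} \<union> {r - q div 2..<r} \<union> (if odd q then {r div 2} else {}))"
    (is "_ \<longleftrightarrow> j \<in> ?f ` ?D")
proof -
  have fwd: "[j = i + d] (mod r) \<longleftrightarrow> j = ?f d" if "j < r" for d
    using that by (simp add: cong_def)
  have bwd: "[i = j + d] (mod r) \<longleftrightarrow> j = ?f (r - d)" if "j < r" "d \<le> r" for d
  proof -
    \<comment> \<open>Adding \<open>r - d\<close> to both sides turns the right side into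
      \<open>j + r\<close>; the assumption \<open>d \<le> r\<close> keeps this difference from
      truncating.\<close>
    have "[i = j + d] (mod r) \<longleftrightarrow> [i + (r - d) = j + d + (r - d)] (mod r)"
      by (simp only: cong_add_rcancel_nat)
    also have "\<dots> \<longleftrightarrow> j = ?f (r - d)"
      using that by (auto simp: cong_def)
    finally show ?thesis .
  qed
  show ?thesis
  proof
    assume "(i, j) \<in> parcs (circulant r q)"
    then have j: "j < r" and "(\<exists>d \<in> {1..q div 2}. [j = i + d] (mod r) \<or> [i = j + d] (mod r)) \<or>
      (odd q \<and> [j = i + r div 2] (mod r))"
      by (auto simp: parcs_circulant)
    then consider d where "d \<in> {1..q div 2}" "j = ?f d"
      | d where "d \<in> {1..q div 2}" "j = ?f (r - d)" | "odd q" "j = ?f (r div 2)"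
      using assms fwd[OF j] bwd[OF j] by auto
    then show "j \<in> ?f ` ?D"
    proof cases
      case 2
      then have "r - d \<in> ?D" using assms by auto
      then show ?thesis using 2 by blast
    qed auto
  next
    assume "j \<in> ?f ` ?D"
    then obtain d where d: "d \<in> ?D" "j = ?f d" by blast
    then have j: "j < r" using assms by simp
    have "r - d \<in> {1..q div 2} \<and> d \<le> r" if "d \<in> {r - q div 2..<r}"
      using that assms by auto
    with d(1) consider "d \<in> {1..q div 2}" | "r - d \<in> {1..q div 2}" "d \<le> r" | "odd q" "d = r div 2"
      by (cases "odd q") (simp_all del: atLeastAtMost_iff atLeastLessThan_iff, blast+)
    then show "(i, j) \<in> parcs (circulant r q)"
    proof cases
      case 2
      then have "[i = j + (r - d)] (mod r)"
        using d(2) bwd[OF j, of "r - d"] by simp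
      then show ?thesis
        using 2(1) j \<open>i < r\<close> unfolding parcs_circulant by blast
    qed (use d(2) j fwd[OF j] \<open>i < r\<close> in \<open>auto simp: parcs_circulant\<close>)
  qed
qed

lemma inj_on_add_mod: "inj_on (\<lambda>d. (i + d) mod r) {..<r::nat}"
proof (rule inj_onI)
  fix x y assume "x \<in> {..<r}" "y \<in> {..<r}" "(i + x) mod r = (i + y) mod r"
  then show "x = y"
    using cong_add_lcancel_nat[of i x y r] by (simp add: cong_def)
qed

text \<open>The forward and backward steps are disjoint because
  \<open>2 * (q div 2) \<le> q < r\<close>. For odd \<open>q\<close> the number \<open>r\<close> is
  even, hence at least \<open>q + 1\<close>, and the half turn \<open>r div 2\<close> lies strictly
  between the two blocks.\<close>

lemma deg_circulant:
  assumes "q < r" "even (q * r)" "i < r"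
  shows "deg (circulant r q) i = q"
proof -
  let ?D = "{1..q div 2} \<union> {r - q div 2..<r} \<union> (if odd q then {r div 2} else {})"
  have "?D \<subseteq> {..<r}" using assms by auto
  then have "inj_on (\<lambda>d. (i + d) mod r) ?D"
    by (rule inj_on_subset[OF inj_on_add_mod])
  then have "deg (circulant r q) i = card ?D"
    using parcs_circulant_iff[OF assms(1,3)] by (rule deg_eq_card_image)
  also have "\<dots> = q"
  proof -
    have disj: "{1..q div 2} \<inter> {r - q div 2..<r} = {}"
      using assms by auto
    have c: "card ({1..q div 2} \<union> {r - q div 2..<r}) = 2 * (q div 2)"
      using assms disj by (subst card_Un_disjoint) auto
    show ?thesis
    proof (cases "odd q")
      case True
      then have "even r" using assms by simp
      with True assms have "r div 2 \<notin> {1..q div 2} \<union> {r - q div 2..<r}"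
        by (auto elim!: oddE evenE)
      then have "card ?D = Suc (card ({1..q div 2} \<union> {r - q div 2..<r}))"
        using True by simp
      then show ?thesis using c True by simp
    qed (use c in auto)
  qed
  finally show ?thesis .
qed

text \<open>A loop would be a step of length 0, which the step set excludes. Reversing an arc swaps
  the forward and backward clauses, and the half turn is its own inverse since \<open>r\<close> is
  even when \<open>q\<close> is odd.\<close>

lemma pair_graph_circulant:
  assumes "q < r" "even (q * r)"
  shows "pair_graph (circulant r q)"
proof (rule pair_graphI)
  fix u v assume uv: "(u, v) \<in> parcs (circulant r q)"
  then have less: "u < r" "v < r"
    by (auto simp: parcs_circulant)
  let ?D = "{1..q div 2} \<union> {r - q div 2..<r} \<union> (if odd q then {r div 2} else {})"
  have D: "?D \<subseteq> {..<r}" "0 \<notin> ?D"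
    using assms by (auto elim!: oddE)
  obtain d where d: "d \<in> ?D" "v = (u + d) mod r"
    using uv unfolding parcs_circulant_iff[OF assms(1) less(1)] by blast
  have neq: "u \<noteq> v"
  proof
    assume "u = v"
    then have "(u + d) mod r = (u + 0) mod r"
      using d(2) less by simp
    moreover have "d \<in> {..<r}" "0 \<in> {..<r}"
      using D(1) d(1) less by auto
    ultimately have "d = 0"
      by (rule inj_onD[OF inj_on_add_mod])
    then show False
      using D(2) d(1) by blast
  qed
  have "[u = v + r div 2] (mod r)" if "odd q" "[v = u + r div 2] (mod r)"
  proof -
    have "even r" using that assms by simp
    have "[v + r div 2 = u + r div 2 + r div 2] (mod r)"
      using that by (intro cong_add) auto
    also have "u + r div 2 + r div 2 = u + r"
      using \<open>even r\<close> by (auto elim!: evenE)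
    finally show ?thesis
      by (simp add: cong_def)
  qed
  with uv have "(v, u) \<in> parcs (circulant r q)"
    by (auto simp: parcs_circulant)
  with neq less show "u \<in> pverts (circulant r q) \<and> u \<noteq> v \<and> (v, u) \<in> parcs (circulant r q)"
    by simp
qed simp

text \<open>For \<open>q \<ge> 2\<close> the step 1 is available. The arcs are oriented along the
  walk \<open>0, r - 1, r - 2, ...\<close>, the direction used for connectivity of the ring.\<close>

lemma circulant_cycle_arcs:
  assumes "2 \<le> q" "q < r"
  shows "Suc i < r \<Longrightarrow> (Suc i, i) \<in> parcs (circulant r q)"
    and "(0, r - 1) \<in> parcs (circulant r q)"
proof -
  have "1 \<in> {1..q div 2}" using assms by auto
  then show "Suc i < r \<Longrightarrow> (Suc i, i) \<in> parcs (circulant r q)"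
    and "(0, r - 1) \<in> parcs (circulant r q)"
    using assms by (auto simp: parcs_circulant cong_def intro!: bexI[of _ 1])
qed

section \<open>Twisted disjoint unions\<close>

text \<open>Here \<open>\<sigma> i u v\<close> is the component to which the arc
  \<open>(u, v)\<close> of component \<open>i\<close> is redirected. The identity choice gives the
  disjoint union, and a cyclic shift on selected arcs gives the connected graph.\<close>

definition twisted_union ::
  "'i set \<Rightarrow> ('i \<Rightarrow> 'a pair_pre_digraph) \<Rightarrow> ('i \<Rightarrow> 'a \<Rightarrow> 'a \<Rightarrow> 'i) \<Rightarrow> ('i \<times> 'a) pair_pre_digraph" where
  "twisted_union I H \<sigma> =
     \<lparr> pverts = Sigma I (\<lambda>i. pverts (H i)),
       parcs = {((i, u), (\<sigma> i u v, v)) | i u v. i \<in> I \<and> (u, v) \<in> parcs (H i)} \<rparr>"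

lemma disjoint_union_eq_twisted_union: "disjoint_union I H = twisted_union I H (\<lambda>i _ _. i)"
  by (simp add: disjoint_union_def twisted_union_def)

lemma twisted_union_cong:
  assumes "\<And>i. i \<in> I \<Longrightarrow> H i = H' i"
  shows "twisted_union I H \<sigma> = twisted_union I H' \<sigma>"
  using assms by (auto simp: twisted_union_def)

lemma pverts_twisted_union [simp]: "pverts (twisted_union I H \<sigma>) = Sigma I (\<lambda>i. pverts (H i))"
  by (simp add: twisted_union_def)

lemma parcs_twisted_union [simp]:
  "((i, u), (j, v)) \<in> parcs (twisted_union I H \<sigma>) \<longleftrightarrow> i \<in> I \<and> (u, v) \<in> parcs (H i) \<and> j = \<sigma> i u v"
  by (auto simp: twisted_union_def)

text \<open>Redirection changes only the component of a neighbour; the neighbours remain distinct in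
  their second coordinates.\<close>

lemma deg_twisted_union:
  assumes "i \<in> I"
  shows "deg (twisted_union I H \<sigma>) (i, u) = deg (H i) u"
proof -
  have "deg (twisted_union I H \<sigma>) (i, u) = card {v. (u, v) \<in> parcs (H i)}"
  proof (rule deg_eq_card_image)
    show "inj_on (\<lambda>v. (\<sigma> i u v, v)) {v. (u, v) \<in> parcs (H i)}"
      by (simp add: inj_on_def)
    show "((i, u), w) \<in> parcs (twisted_union I H \<sigma>) \<longleftrightarrow>
        w \<in> (\<lambda>v. (\<sigma> i u v, v)) ` {v. (u, v) \<in> parcs (H i)}" for w
      using assms by (cases w) auto
  qed
  then show ?thesis
    by (simp only: deg_eq_card)
qed

text \<open>The hypothesis \<open>twist\<close> says that the redirected reverse arc exists and
  leads back. Loops cannot arise, as the second coordinates of the endpoints already differ.\<close>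

lemma pair_graph_twisted_union:
  assumes "finite I" "\<And>i. i \<in> I \<Longrightarrow> pair_graph (H i)"
    and twist: "\<And>i u v. i \<in> I \<Longrightarrow> (u, v) \<in> parcs (H i) \<Longrightarrow>
      \<sigma> i u v \<in> I \<and> (v, u) \<in> parcs (H (\<sigma> i u v)) \<and> \<sigma> (\<sigma> i u v) v u = i"
  shows "pair_graph (twisted_union I H \<sigma>)"
proof (rule pair_graphI)
  show "finite (pverts (twisted_union I H \<sigma>))"
    using assms(1,2) by (auto simp: pair_graph_def pair_digraph_def pair_fin_digraph_def pair_fin_digraph_axioms_def)
next
  fix x y assume xy: "(x, y) \<in> parcs (twisted_union I H \<sigma>)"
  obtain i u where x: "x = (i, u)" by fastforce
  obtain j v where y: "y = (j, v)" by fastforce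
  have arc: "i \<in> I" "(u, v) \<in> parcs (H i)" "j = \<sigma> i u v"
    using xy unfolding x y by simp_all
  interpret pair_graph "H i" using assms(2) arc by blast
  from arc show "x \<in> pverts (twisted_union I H \<sigma>) \<and> x \<noteq> y \<and> (y, x) \<in> parcs (twisted_union I H \<sigma>)"
    unfolding x y using twist by (auto dest: no_loops' in_arcsD1)
qed

text \<open>Induction on the number of components: the last one contributes a constant multiset of
  size \<open>r N\<close>.\<close>

lemma image_mset_Sigma_lessThan:
  "image_mset (\<lambda>(i, u). f i) (mset_set (SIGMA i:{..<N}. {..<r i}))
     = mset (concat (map (\<lambda>i. replicate (r i) (f i)) [0..<N]))" for N :: nat and r :: "nat \<Rightarrow> nat"
proof (induction N)
  case (Suc N)
  have "(SIGMA i:{..<Suc N}. {..<r i}) = (SIGMA i:{..<N}. {..<r i}) \<union> {N} \<times> {..<r N}"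
    by (auto simp: less_Suc_eq)
  then have "mset_set (SIGMA i:{..<Suc N}. {..<r i})
      = mset_set (SIGMA i:{..<N}. {..<r i}) + mset_set ({N} \<times> {..<r N})"
    by (simp add: mset_set_Union disjoint_iff)
  moreover have "image_mset (\<lambda>(i, u). f i) (mset_set ({N} \<times> {..<r N})) = replicate_mset (r N) (f N)"
    by (subst image_mset_cong[where g = "\<lambda>_. f N"]) (auto simp: image_mset_const_eq)
  ultimately show ?case using Suc by simp
qed simp

text \<open>Degrees are insensitive to the twist, so one statement serves both the disjoint union
  and the ring.\<close>

lemma has_degree_sequence_twisted_union:
  assumes "\<And>i. i < N \<Longrightarrow> pverts (H i) = {..<r i}"
    and "\<And>i u. i < N \<Longrightarrow> u < r i \<Longrightarrow> deg (H i) u = q i"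
  shows "has_degree_sequence (twisted_union {..<N} H \<sigma>)
    (concat (map (\<lambda>i. replicate (r i) (q i)) [0..<N]))"
proof -
  have "(SIGMA i:{..<N}. pverts (H i)) = (SIGMA i:{..<N}. {..<r i})"
    using assms(1) by auto
  then have "image_mset (deg (twisted_union {..<N} H \<sigma>)) (mset_set (pverts (twisted_union {..<N} H \<sigma>)))
      = image_mset (\<lambda>(i, u). q i) (mset_set (SIGMA i:{..<N}. {..<r i}))"
    using assms(2) by (auto intro!: image_mset_cong simp: deg_twisted_union)
  then show ?thesis
    by (simp add: has_degree_sequence_def image_mset_Sigma_lessThan)
qed

text \<open>The edges \<open>{(i, 0), (i, 1)}\<close> of the disjoint union are replaced by \<open>{(i, 1), (i + 1, 0)}\<close>,
  with \<open>i\<close> cyclic modulo \<open>N\<close>.\<close>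

definition ring_twist :: "nat \<Rightarrow> nat \<Rightarrow> nat \<Rightarrow> nat \<Rightarrow> nat" where
  "ring_twist N i u v =
     (if u = 1 \<and> v = 0 then (i + 1) mod N else if u = 0 \<and> v = 1 then (i + N - 1) mod N else i)"

text \<open>Arcs from 1 to 0 move to the next component and arcs from 0 to 1 to the previous one.
  These shifts are mutually inverse, and every component contains the edge between 0 and 1.\<close>

lemma pair_graph_ring_of_circulants:
  assumes "\<And>i. i < N \<Longrightarrow> 2 \<le> q i \<and> q i < r i \<and> even (q i * r i)"
  shows "pair_graph (twisted_union {..<N} (\<lambda>i. circulant (r i) (q i)) (ring_twist N))"
proof (rule pair_graph_twisted_union)
  fix i assume "i \<in> {..<N}"
  then show "pair_graph (circulant (r i) (q i))"
    using assms by (simp add: pair_graph_circulant)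
next
  fix i u v assume i: "i \<in> {..<N}" and uv: "(u, v) \<in> parcs (circulant (r i) (q i))"
  have sym: "(y, x) \<in> parcs (circulant (r j) (q j))" if "j < N" "(x, y) \<in> parcs (circulant (r j) (q j))" for j x y
  proof -
    interpret pair_graph "circulant (r j) (q j)"
      using assms that by (simp add: pair_graph_circulant)
    show ?thesis using that by (simp add: arcs_symmetric)
  qed
  have arc: "(1, 0) \<in> parcs (circulant (r j) (q j))" if "j < N" for j
    using assms[OF that] circulant_cycle_arcs(1)[of "q j" "r j" 0] by auto
  \<comment> \<open>Adding \<open>N\<close> before subtracting 1 prevents truncation when the index
    is 0.\<close>
  have next_prev: "((i + 1) mod N + N - 1) mod N = i" "((i + N - 1) mod N + 1) mod N = i"
  proof -
    have N: "N > 0" "i mod N = i" using i by auto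
    have "((i + 1) mod N + N - 1) mod N = ((i + 1) mod N + (N - 1)) mod N"
      using N by (simp add: Suc_leI)
    also have "\<dots> = (i + 1 + (N - 1)) mod N"
      by (simp only: mod_add_left_eq)
    also have "i + 1 + (N - 1) = i + N" using N by simp
    finally show "((i + 1) mod N + N - 1) mod N = i"
      using N by simp
    have "((i + N - 1) mod N + 1) mod N = (i + N - 1 + 1) mod N"
      by (simp only: mod_add_left_eq)
    also have "i + N - 1 + 1 = i + N" using N by simp
    finally show "((i + N - 1) mod N + 1) mod N = i"
      using N by simp
  qed
  have less: "(i + 1) mod N < N" "(i + N - 1) mod N < N"
    using i by (auto intro!: mod_less_divisor)
  consider "u = 1" "v = 0" | "u = 0" "v = 1" | "\<not> (u = 1 \<and> v = 0)" "\<not> (u = 0 \<and> v = 1)"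
    by blast
  then show "ring_twist N i u v \<in> {..<N}
      \<and> (v, u) \<in> parcs (circulant (r (ring_twist N i u v)) (q (ring_twist N i u v)))
      \<and> ring_twist N (ring_twist N i u v) v u = i"
  proof cases
    case 1
    then show ?thesis
      using less(1) next_prev(1) sym[OF less(1) arc[OF less(1)]] by (simp add: ring_twist_def)
  next
    case 2
    then show ?thesis
      using less(2) next_prev(2) arc[OF less(2)] by (simp add: ring_twist_def)
  next
    case 3
    then have "ring_twist N i u v = i" "ring_twist N i v u = i"
      unfolding ring_twist_def by argo+
    moreover have "(v, u) \<in> parcs (circulant (r i) (q i))"
      using i by (intro sym[OF _ uv]) simp
    ultimately show ?thesis
      using i by (simp only: simp_thms)
  qed
qed simp

text \<open>Within component \<open>i\<close> the walk \<open>0, r i - 1, ..., 1\<close> avoids the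
  removed edge and meets every vertex; from 1 the bridging arc enters the next component at
  0.\<close>

lemma connected_ring_of_circulants:
  assumes "N > 0" and q: "\<And>i. i < N \<Longrightarrow> 2 \<le> q i \<and> q i < r i \<and> even (q i * r i)"
  shows "Digraph_Component.connected
    (with_proj (twisted_union {..<N} (\<lambda>i. circulant (r i) (q i)) (ring_twist N)))"
    (is "Digraph_Component.connected (with_proj ?G)")
proof -
  interpret pair_graph ?G by (rule pair_graph_ring_of_circulants) (rule q)
  let ?R = "\<lambda>i u. reachable (with_proj ?G) (0, 0) (i, u)"
  have around: "?R i u" if "?R i 0" "i < N" "u < r i" for i u
  proof (cases "u = 0")
    case False
    have "?R i (r i - 1 - d)" if "d < r i - 1" for d
      using that
    proof (induction d)
      case 0
      \<comment> \<open>Since \<open>r i > 2\<close>, the vertex \<open>r i - 1\<close> is not 1, so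
        this arc stays in its component.\<close>
      have "((i, 0), (i, r i - 1)) \<in> parcs ?G"
        using q[OF \<open>i < N\<close>] \<open>i < N\<close> circulant_cycle_arcs(2)[of "q i" "r i"]
        by (auto simp: ring_twist_def)
      with \<open>?R i 0\<close> have "?R i (r i - 1)"
        by (rule reachable_adj_trans)
      then show ?case by simp
    next
      case (Suc d)
      let ?v = "r i - 1 - Suc d"
      \<comment> \<open>The fact \<open>?v \<noteq> 0\<close> rules out the arc from 1 to 0, the
        only downward step that is redirected.\<close>
      have v: "r i - 1 - d = Suc ?v" "Suc ?v < r i" "?v \<noteq> 0"
        using Suc.prems by auto
      have "((i, Suc ?v), (i, ?v)) \<in> parcs ?G"
        using q[OF \<open>i < N\<close>] \<open>i < N\<close> circulant_cycle_arcs(1)[of "q i" "r i" ?v] v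
        by (simp add: ring_twist_def)
      moreover have "?R i (Suc ?v)"
        using Suc v(1) by simp
      ultimately show ?case
        by (rule reachable_adj_trans[rotated])
    qed
    from this[of "r i - 1 - u"] show ?thesis
      using False \<open>u < r i\<close> by simp
  qed (use that in simp)
  have start: "?R i 0" if "i < N" for i
    using that
  proof (induction i)
    case 0
    then have "(0, 0) \<in> pverts ?G" using q[of 0] by simp
    then show ?case by simp
  next
    case (Suc i)
    then have "?R i 0" "i < N" "1 < r i"
      using q[of i] by simp_all
    then have "?R i 1"
      by (rule around)
    \<comment> \<open>As \<open>Suc i < N\<close>, the cyclic successor of \<open>i\<close> does not
      wrap around.\<close>
    moreover have "((i, 1), (Suc i, 0)) \<in> parcs ?G"
      using q[of i] Suc.prems circulant_cycle_arcs(1)[of "q i" "r i" 0]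
      by (simp add: ring_twist_def)
    ultimately show ?case
      by (rule reachable_adj_trans)
  qed
  show ?thesis
  proof (rule connected_if_reachable_from)
    show "(0, 0) \<in> pverts ?G"
      using q[of 0] \<open>N > 0\<close> by auto
  next
    fix x assume "x \<in> pverts ?G"
    then obtain i u where "x = (i, u)" "i < N" "u < r i" by auto
    then show "reachable (with_proj ?G) (0, 0) x"
      using around[OF start] by blast
  qed (rule pair_graph)
qed

section \<open>Largest sets of bounded spread\<close>

lemma max_spread_card_eqI:
  assumes "finite (pverts G)" "A \<subseteq> pverts G" "A \<noteq> {}" "spread G A \<le> k" "card A = s"
    and "\<And>B. B \<subseteq> pverts G \<Longrightarrow> B \<noteq> {} \<Longrightarrow> spread G B \<le> k \<Longrightarrow> card B \<le> s"
  shows "max_spread_card G k = s"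
  unfolding max_spread_card_def
proof (rule Max_eqI)
  have "{card B |B. B \<subseteq> pverts G \<and> B \<noteq> {} \<and> spread G B \<le> k} \<subseteq> card ` Pow (pverts G)"
    by auto
  then show "finite {card B |B. B \<subseteq> pverts G \<and> B \<noteq> {} \<and> spread G B \<le> k}"
    by (rule finite_subset) (use assms(1) in simp)
  show "s \<in> {card B |B. B \<subseteq> pverts G \<and> B \<noteq> {} \<and> spread G B \<le> k}"
    using assms(2-5) by blast
  show "x \<le> s" if "x \<in> {card B |B. B \<subseteq> pverts G \<and> B \<noteq> {} \<and> spread G B \<le> k}" for x
    using that assms(6) by blast
qed

lemma deg_diff_le_spread:
  assumes "finite B" "u \<in> B" "v \<in> B"
  shows "deg G u - deg G v \<le> spread G B"
proof -
  have "deg G u \<le> Max (deg G ` B)" "Min (deg G ` B) \<le> deg G v"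
    using assms by simp_all
  then show ?thesis
    unfolding spread_def by linarith
qed

section \<open>The extremal disjoint union and its connected companion\<close>

theorem proposition11:
  fixes \<delta> k h t n m s b :: nat
    and P :: "nat list"
    and G0 :: "(nat \<times> nat) pair_pre_digraph"
  assumes "\<delta> \<ge> 1" and "h = k + 1" and "t \<ge> 1" and "n \<ge> 2"
    and "2 * m \<ge> n * \<delta>"
    and "real n / (real t + 1) \<le> real s" and "real s \<le> real n / real t"
    and "2 * real m = real n * (real \<delta> + real t * real h)
           - real s * real h * real t * (real t + 1) / 2"
    and "b = n - t * s"
    and "P = concat (map (\<lambda>i. replicate s (\<delta> + i * h)) [0..<t]) @ replicate (n - t * s) (\<delta> + t * h)"
    and "s \<ge> \<delta> + (t - 1) * h + 1"
    and "\<forall>i<t. even (s * (\<delta> + i * h))"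
    and "b = 0 \<or> (b \<ge> \<delta> + t * h + 1 \<and> even (b * (\<delta> + t * h)))"
    and "G0 = disjoint_union ({..<t} \<union> (if b > 0 then {t} else {}))
                (\<lambda>i. if i < t then circulant s (\<delta> + i * h) else circulant b (\<delta> + t * h))"
  shows "pair_graph G0 \<and> has_degree_sequence G0 P
       \<and> max_spread_card G0 k = s \<and> real s = spread_bound t n m \<delta> k
       \<and> (\<delta> \<ge> 2 \<longrightarrow>
            (\<exists>H :: nat pair_pre_digraph. pair_graph H \<and> Digraph_Component.connected (with_proj H)
               \<and> has_degree_sequence H P))"
proof -
  define N where "N = (if b > 0 then t + 1 else t)"
  define r where "r i = (if i < t then s else b)" for i
  define q where "q i = \<delta> + i * h" for i
  have N: "N > 0" "t \<le> N" "{..<t} \<union> (if b > 0 then {t} else {}) = {..<N}"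
    using \<open>t \<ge> 1\<close> by (auto simp: N_def)
  have "real (t * s) \<le> real n"
    using assms(3,7) by (simp add: field_simps)
  then have "t * s \<le> n" by linarith
  \<comment> \<open>The lower bound on \<open>s\<close> makes the remainder component no larger than
    the others.\<close>
  have "real n \<le> real (s * (t + 1))"
    using assms(6) by (simp add: field_simps)
  then have "n \<le> s * (t + 1)" by linarith
  then have "b \<le> s"
    using \<open>b = n - t * s\<close> by (simp add: algebra_simps)
  have q: "q i < r i \<and> even (q i * r i)" if "i < N" for i
  proof (cases "i < t")
    case True
    \<comment> \<open>The hypothesis on \<open>s\<close> concerns the largest degree among the first
      \<open>t\<close> components, which dominates the rest.\<close>
    then have "i * h \<le> (t - 1) * h" by (intro mult_right_mono) auto
    then have "\<delta> + i * h < s"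
      using assms(11) by linarith
    moreover have "even (s * (\<delta> + i * h))"
      using True assms(12) by blast
    ultimately show ?thesis
      using True by (simp add: q_def r_def mult.commute)
  next
    case False
    then have "i = t" "b > 0" using that by (auto simp: N_def split: if_splits)
    then show ?thesis using assms(13) by (simp add: q_def r_def mult.commute)
  qed
  have P: "P = concat (map (\<lambda>i. replicate (r i) (q i)) [0..<N])"
  proof -
    have "map (\<lambda>i. replicate s (\<delta> + i * h)) [0..<t] = map (\<lambda>i. replicate (r i) (q i)) [0..<t]"
      by (simp add: r_def q_def)
    moreover have "replicate (n - t * s) (\<delta> + t * h) = replicate (r t) (q t)"
      by (simp add: r_def q_def \<open>b = n - t * s\<close>)
    ultimately have "P = concat (map (\<lambda>i. replicate (r i) (q i)) [0..<t]) @ replicate (r t) (q t)"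
      using assms(10) by (simp only:)
    \<comment> \<open>If \<open>b = 0\<close>, the final block is empty and the list over the first
      \<open>t\<close> components is complete.\<close>
    then show ?thesis
      by (cases "b > 0") (simp_all add: N_def r_def[of t])
  qed
  let ?C = "\<lambda>i. circulant (r i) (q i)"
  have G0: "G0 = twisted_union {..<N} ?C (\<lambda>i _ _. i)"
    unfolding assms(14) disjoint_union_eq_twisted_union N(3)
    by (rule twisted_union_cong) (auto simp: r_def q_def N_def less_Suc_eq split: if_splits)
  have deg_C: "deg (?C i) u = q i" if "i < N" "u < r i" for i u
    using q[OF that(1)] that(2) by (simp add: deg_circulant)
  have degseq: "has_degree_sequence (twisted_union {..<N} ?C \<sigma>) P" for \<sigma>
    unfolding P by (rule has_degree_sequence_twisted_union) (simp_all add: deg_C)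
  have "pair_graph G0"
    unfolding G0
  proof (rule pair_graph_twisted_union)
    fix i u v assume arc: "i \<in> {..<N}" "(u, v) \<in> parcs (?C i)"
    then interpret pair_graph "?C i"
      using q by (simp add: pair_graph_circulant)
    from arc show "i \<in> {..<N} \<and> (v, u) \<in> parcs (?C i) \<and> i = i"
      by (simp add: arcs_symmetric)
  qed (use q in \<open>auto simp: pair_graph_circulant\<close>)
  moreover have "max_spread_card G0 k = s"
  proof -
    have V: "pverts G0 = (SIGMA i:{..<N}. {..<r i})"
      by (simp add: G0)
    have fin: "finite (pverts G0)"
      by (simp add: V)
    have deg_G0: "deg G0 (i, u) = q i" if "(i, u) \<in> pverts G0" for i u
      using that by (auto simp: V G0 deg_twisted_union deg_C)
    have "s > 0" using assms(11) by simp
    show ?thesis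
    proof (rule max_spread_card_eqI)
      \<comment> \<open>Component 0 is the witness: it has \<open>s\<close> vertices of equal
        degree, hence spread 0.\<close>
      show "{0} \<times> {..<s} \<subseteq> pverts G0"
        using N(1) \<open>t \<ge> 1\<close> by (auto simp: V r_def)
      then have "deg G0 ` ({0} \<times> {..<s}) = {q 0}"
        using \<open>s > 0\<close> deg_G0 by force
      then show "spread G0 ({0} \<times> {..<s}) \<le> k"
        by (simp add: spread_def)
    next
      fix B assume B: "B \<subseteq> pverts G0" "B \<noteq> {}" "spread G0 B \<le> k"
      then have "finite B" using fin finite_subset by blast
      from B(2) obtain i u where iu: "(i, u) \<in> B" by fastforce
      have "j = i" if "(j, v) \<in> B" for j v
      proof -
        have "deg G0 (i, u) = q i" "deg G0 (j, v) = q j"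
          using B(1) iu that by (auto intro: deg_G0)
        \<comment> \<open>Both orders are taken because natural subtraction truncates.\<close>
        then have "q i - q j \<le> k" "q j - q i \<le> k"
          using deg_diff_le_spread[OF \<open>finite B\<close> iu that, of G0]
            deg_diff_le_spread[OF \<open>finite B\<close> that iu, of G0] B(3) by linarith+
        \<comment> \<open>Distinct components differ in degree by at least \<open>h = k + 1\<close>,
          too much for spread \<open>k\<close>.\<close>
        moreover have "q x + h \<le> q y" if "x < y" for x y
          using mult_le_mono1[of "Suc x" y h] that by (simp add: q_def)
        ultimately show "j = i"
          using \<open>h = k + 1\<close> by (cases i j rule: linorder_cases) fastforce+
      qed
      then have "B \<subseteq> {i} \<times> {..<r i}"
        using B(1) by (fastforce simp: V)
      then have "card B \<le> card ({i} \<times> {..<r i})"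
        by (intro card_mono) auto
      also have "\<dots> \<le> s"
        using \<open>b \<le> s\<close> by (simp add: r_def)
      finally show "card B \<le> s" .
    qed (use fin \<open>s > 0\<close> in auto)
  qed
  moreover have "real s = spread_bound t n m \<delta> k"
  proof -
    \<comment> \<open>The bound is the equation for \<open>2 * real m\<close> solved for
      \<open>s\<close>, and this is the denominator.\<close>
    have "(real k + 1) * real t * (real t + 1) \<noteq> 0"
      using \<open>t \<ge> 1\<close> by auto
    then show ?thesis
      using assms(2,8) by (simp add: spread_bound_def field_simps)
  qed
  moreover have "\<exists>H :: nat pair_pre_digraph. pair_graph H
      \<and> Digraph_Component.connected (with_proj H) \<and> has_degree_sequence H P" if "\<delta> \<ge> 2"
  proof -
    let ?R = "twisted_union {..<N} ?C (ring_twist N)"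
    \<comment> \<open>The assumption \<open>\<delta> \<ge> 2\<close> supplies the Hamiltonian cycle
      in each component.\<close>
    have q2: "2 \<le> q i \<and> q i < r i \<and> even (q i * r i)" if "i < N" for i
      using q[OF that] \<open>\<delta> \<ge> 2\<close> by (simp add: q_def)
    have "pair_graph ?R" "Digraph_Component.connected (with_proj ?R)"
      using q2 N(1) by (simp_all add: pair_graph_ring_of_circulants connected_ring_of_circulants)
    then show ?thesis
      using degseq[of "ring_twist N"]
      by (intro exI[of _ "map_graph prod_encode ?R"] conjI pair_graph_map_graph connected_map_graph
          has_degree_sequence_map_graph inj_prod_encode)
  qed
  ultimately show ?thesis
    using degseq[of "\<lambda>i _ _. i"] by (simp add: G0)
qed

end
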